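(* Let $\mathbf u\in\{0,1\}^{\mathbb N}$ be uniformly recurrent. If $\mathbf u$ is almost $R$-rich, then $S(\mathbf u)$ is almost $R$-rich.
   Context: $R$ is the reversal map on finite words. For a finite word $w$, $\mathrm{Pal}^R(w)$ is the set of palindromic factors of $w$ including the empty word and $D^R(w)=|w|+1-\#\mathrm{Pal}^R(w)$; for an infinite word $\mathbf u$, $D^R(\mathbf u)=\sup\{D^R(w): w \text{ a finite factor of } \mathbf u\}$, and $\mathbf u$ is almost $R$-rich if $D^R(\mathbf u)<\infty$. $S(u_0u_1u_2\cdots)=v_1v_2\cdots$ with $v_i=(u_{i-1}+u_i)\bmod2$. An infinite word is uniformly recurrent if every factor occurs infinitely often with bounded gaps between consecutive occurrences. *)

theory Defs
  imports "HOL-Library.Omega_Words_Fun" "HOL-Library.Sublist" "HOL-Library.Extended_Real"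
begin

text \<open>
  Finite words are lists and infinite words are functions on \<^typ>\<open>nat\<close>
  (type \<^typ>\<open>'a word\<close> of the library). The reversal map is \<^const>\<open>rev\<close>, and the factor
  relation between finite words is \<^const>\<open>sublist\<close> (contiguous sublists).
\<close>

definition occurs_at :: "'a list \<Rightarrow> 'a word \<Rightarrow> nat \<Rightarrow> bool" where
  "occurs_at w u i \<longleftrightarrow> subsequence u i (i + length w) = w"

definition factors :: "'a word \<Rightarrow> 'a list set" where
  "factors u = {w. \<exists>i. occurs_at w u i}"

definition uniformly_recurrent :: "'a word \<Rightarrow> bool" where
  "uniformly_recurrent u \<longleftrightarrow>
     (\<forall>w \<in> factors u. infinite {i. occurs_at w u i} \<and>
        (\<exists>K. \<forall>i j. i < j \<and> occurs_at w u i \<and> occurs_at w u j \<and>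
               (\<forall>k. i < k \<and> k < j \<longrightarrow> \<not> occurs_at w u k) \<longrightarrow> j - i \<le> K))"

definition Pal :: "'a list \<Rightarrow> 'a list set" where
  "Pal w = {p. sublist p w \<and> rev p = p}"

text \<open>
  The defect is an integer, so that no truncated subtraction is involved; the supremum
  is taken in \<^typ>\<open>ereal\<close>, so that it may be infinite.
\<close>

definition defect :: "'a list \<Rightarrow> int" where
  "defect w = int (length w) + 1 - int (card (Pal w))"

definition defect_inf :: "'a word \<Rightarrow> ereal" where
  "defect_inf u = (SUP w \<in> factors u. ereal (real_of_int (defect w)))"

definition almost_rich :: "'a word \<Rightarrow> bool" where
  "almost_rich u \<longleftrightarrow> defect_inf u < \<infinity>"

text \<open>
  With \<open>v\<^sub>i = (u\<^sub>i\<^sub>-\<^sub>1 + u\<^sub>i) mod 2\<close> for \<open>i \<ge> 1\<close>, the word \<open>v\<^sub>1v\<^sub>2\<dots>\<close> is indexed from 0 here.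
\<close>

definition S :: "nat word \<Rightarrow> nat word" where
  "S u = (\<lambda>i. (u i + u (i + 1)) mod 2)"

end

theory Submission
  imports Defs
begin

text \<open>
  An infinite word is almost rich iff all but finitely many of its positions end a palindrome
  that has not occurred before. Let \<open>p\<close> be such a new, long palindrome of \<open>u\<close>, and write \<open>E\<close> for the
  exchange of letters; \<open>S\<close> identifies exactly the factors \<open>f\<close> and \<open>E f\<close>, and \<open>S f\<close> is a palindrome iff
  \<open>rev f\<close> is \<open>f\<close> or \<open>E f\<close>. If \<open>E p\<close> has not occurred before, \<open>S p\<close> is a new palindrome. Otherwise the
  factors of \<open>u\<close> are closed under \<open>E\<close>, because \<open>p\<close> is long. Let \<open>f\<close> lead from the last
  occurrence of \<open>E p\<close> to \<open>p\<close>. Complete returns to \<open>p\<close> and to \<open>E p\<close> are palindromes, so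
  successive passages between \<open>E p\<close> and \<open>p\<close> are mirror images of each other, and all of them read
  \<open>f\<close> or \<open>rev f\<close>. Since \<open>E f\<close> is a later passage from \<open>p\<close> to \<open>E p\<close>, it equals \<open>rev f\<close>, and \<open>S f\<close> is a
  new palindrome.
\<close>

section \<open>Occurrences and reversal, letter by letter\<close>

lemma occurs_at_iff: "occurs_at w u i \<longleftrightarrow> (\<forall>k < length w. u (i + k) = w ! k)"
  unfolding occurs_at_def list_eq_iff_nth_eq by simp

lemma rev_eq_self_iff: "rev w = w \<longleftrightarrow> (\<forall>k < length w. w ! (length w - Suc k) = w ! k)"
  by (auto simp: list_eq_iff_nth_eq rev_nth)

lemma rev_nth_self: "rev w = w \<Longrightarrow> k < length w \<Longrightarrow> w ! (length w - Suc k) = w ! k"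
  by (simp add: rev_eq_self_iff)

lemma subsequence_in_factors: "subsequence u i (i + l) \<in> factors u"
  by (auto simp: factors_def occurs_at_iff)

lemma sublist_prefix_iff:
  "sublist w (subsequence u 0 n) \<longleftrightarrow> (\<exists>j. j + length w \<le> n \<and> occurs_at w u j)"
proof
  assume "sublist w (subsequence u 0 n)"
  then obtain a b where ab: "subsequence u 0 n = a @ w @ b"
    by (auto simp: sublist_def)
  have len: "length a + length w \<le> n"
    using arg_cong[OF ab, of length] by simp
  have "u (length a + k) = w ! k" if "k < length w" for k
  proof -
    have "subsequence u 0 n ! (length a + k) = w ! k"
      using that by (simp add: ab nth_append)
    then show ?thesis
      using that len by simp
  qed
  with len show "\<exists>j. j + length w \<le> n \<and> occurs_at w u j"
    by (auto simp: occurs_at_iff)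
next
  assume "\<exists>j. j + length w \<le> n \<and> occurs_at w u j"
  then obtain j where j: "j + length w \<le> n" "occurs_at w u j"
    by blast
  have "subsequence u 0 n = subsequence u 0 j @ w @ subsequence u (j + length w) n"
    using j by (auto simp: list_eq_iff_nth_eq occurs_at_iff nth_append)
  then show "sublist w (subsequence u 0 n)"
    by (auto simp: sublist_def)
qed

section \<open>Palindromic factors and monotonicity of the defect\<close>

lemma finite_Pal: "finite (Pal w)"
  by (rule finite_subset[of _ "set (sublists w)"]) (auto simp: Pal_def)

lemma Pal_snoc: "Pal (w @ [x]) = Pal w \<union> {s. suffix s (w @ [x]) \<and> rev s = s}"
  by (auto simp: Pal_def sublist_snoc)

text \<open>A palindromic suffix other than the longest one is also a prefix of the longest one,
  so it occurs before the last letter.\<close>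

lemma Pal_snoc_longest:
  obtains q where "suffix q (w @ [x])" "rev q = q" "q \<noteq> []" "Pal (w @ [x]) = insert q (Pal w)"
proof -
  let ?A = "{s. suffix s (w @ [x]) \<and> rev s = s}"
  have x: "[x] \<in> ?A"
    by (auto simp: Sublist.suffix_def)
  have "\<forall>s. s \<in> ?A \<longrightarrow> length s < Suc (Suc (length w))"
    by (auto dest: suffix_length_le)
  from ex_has_greatest_nat[of "\<lambda>s. s \<in> ?A" "[x]" length, OF x this]
  obtain q where q: "q \<in> ?A" and max: "\<And>s. s \<in> ?A \<Longrightarrow> length s \<le> length q"
    by blast
  have "s \<in> Pal w" if s: "s \<in> ?A" and "s \<noteq> q" for s
  proof -
    have "suffix s q"
      using s q max[OF s] by (intro suffix_length_suffix[of s "w @ [x]" q]) auto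
    then have "Sublist.prefix s q"
      using s q by (simp add: suffix_to_prefix)
    then obtain t where t: "q = s @ t" "t \<noteq> []"
      using \<open>s \<noteq> q\<close> by (auto simp: Sublist.prefix_def)
    obtain a where "w @ [x] = a @ q"
      using q by (auto simp: Sublist.suffix_def)
    then have "w = a @ s @ butlast t"
      using t by (metis append_is_Nil_conv butlast_append butlast_snoc)
    then show ?thesis
      using s by (auto simp: Pal_def)
  qed
  then have "Pal (w @ [x]) = insert q (Pal w)"
    using q by (auto simp: Pal_snoc)
  moreover have "q \<noteq> []"
    using max[OF x] by auto
  ultimately show ?thesis
    using that q by blast
qed

lemma card_Pal_snoc: "card (Pal (w @ [x])) \<le> Suc (card (Pal w))"
  by (rule Pal_snoc_longest[of w x]) (simp add: card_insert_if finite_Pal)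

lemma defect_snoc: "defect w \<le> defect (w @ [x])"
  using card_Pal_snoc[of w x] by (simp add: defect_def)

lemma defect_append: "defect w \<le> defect (w @ v)"
proof (induction v rule: rev_induct)
  case (snoc x v)
  then show ?case
    using defect_snoc[of "w @ v" x] by simp
qed simp

lemma defect_rev: "defect (rev w) = defect w"
proof -
  have "Pal (rev w) = Pal w"
    by (auto simp: Pal_def) (metis sublist_rev)+
  then show ?thesis
    by (simp add: defect_def)
qed

text \<open>Appending a letter adds at most one palindrome, so it never lowers the defect;
  prepending is appending to the reversal, which has the same defect.\<close>

lemma defect_sublist: "sublist w v \<Longrightarrow> defect w \<le> defect v"
proof -
  assume "sublist w v"
  then obtain a b where v: "v = a @ w @ b"
    by (auto simp: sublist_def)
  have "defect w \<le> defect (rev (w @ b))"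
    by (simp only: defect_rev defect_append)
  also have "\<dots> \<le> defect (rev (w @ b) @ rev a)"
    by (rule defect_append)
  also have "\<dots> = defect v"
    by (metis v defect_rev rev_append)
  finally show ?thesis .
qed

section \<open>Almost richness in terms of positions\<close>

text \<open>In other terms, the prefix of length \<open>Suc n\<close> has a unioccurrent palindromic
  suffix; \<open>i\<close> is its start.\<close>

definition new_pal :: "'a word \<Rightarrow> nat \<Rightarrow> bool" where
  "new_pal u n \<longleftrightarrow> (\<exists>i \<le> n. rev (subsequence u i (Suc n)) = subsequence u i (Suc n) \<and>
     (\<forall>j < i. \<not> occurs_at (subsequence u i (Suc n)) u j))"

text \<open>The only word that one more letter can add is the longest palindromic suffix, and it is
  added exactly when it has no earlier start.\<close>

lemma new_pal_iff: "new_pal u n \<longleftrightarrow> Pal (subsequence u 0 (Suc n)) \<noteq> Pal (subsequence u 0 n)"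
proof -
  have snoc: "subsequence u 0 (Suc n) = subsequence u 0 n @ [u n]"
    by simp
  show ?thesis
  proof
    assume "new_pal u n"
    then obtain i where i: "i \<le> n" "rev (subsequence u i (Suc n)) = subsequence u i (Suc n)"
      "\<forall>j < i. \<not> occurs_at (subsequence u i (Suc n)) u j"
      unfolding new_pal_def by blast
    have "subsequence u i (Suc n) \<in> Pal (subsequence u 0 (Suc n))"
      unfolding Pal_def sublist_prefix_iff using i
      by (auto simp: occurs_at_iff simp del: subseq_to_Suc intro!: exI[of _ i])
    moreover have "subsequence u i (Suc n) \<notin> Pal (subsequence u 0 n)"
      unfolding Pal_def sublist_prefix_iff using i
      by (auto simp del: subseq_to_Suc)
    ultimately show "Pal (subsequence u 0 (Suc n)) \<noteq> Pal (subsequence u 0 n)"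
      by blast
  next
    assume neq: "Pal (subsequence u 0 (Suc n)) \<noteq> Pal (subsequence u 0 n)"
    obtain q where q: "suffix q (subsequence u 0 (Suc n))" "rev q = q" "q \<noteq> []"
      "Pal (subsequence u 0 (Suc n)) = insert q (Pal (subsequence u 0 n))"
      by (rule Pal_snoc_longest[of "subsequence u 0 n" "u n", folded snoc])
    have qn: "q \<notin> Pal (subsequence u 0 n)"
      using neq q(4) by (metis insert_absorb)
    obtain a where a: "subsequence u 0 (Suc n) = a @ q"
      using q(1) by (auto simp: Sublist.suffix_def)
    have len: "length a + length q = Suc n"
      using arg_cong[OF a, of length] by (simp del: subseq_to_Suc)
    have "q = drop (length a) (subsequence u 0 (Suc n))"
      by (simp add: a del: subseq_to_Suc)
    then have q_eq: "q = subsequence u (length a) (Suc n)"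
      by (simp add: subsequence_def drop_map del: upt_Suc)
    have "\<not> occurs_at q u j" if "j < length a" for j
    proof
      assume "occurs_at q u j"
      then have "sublist q (subsequence u 0 n)"
        unfolding sublist_prefix_iff using len that by (intro exI[of _ j]) auto
      with qn q(2) show False
        by (simp add: Pal_def)
    qed
    moreover have "length a \<le> n"
      using len q(3) by (cases q) auto
    ultimately show "new_pal u n"
      unfolding new_pal_def using q(2)
      by (intro exI[of _ "length a"], unfold q_eq[symmetric]) blast
  qed
qed

lemma defect_prefix_Suc:
  "defect (subsequence u 0 (Suc n)) = defect (subsequence u 0 n) + (if new_pal u n then 0 else 1)"
proof (rule Pal_snoc_longest[of "subsequence u 0 n" "u n"])
  fix q
  assume "Pal (subsequence u 0 n @ [u n]) = insert q (Pal (subsequence u 0 n))"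
  then have q: "Pal (subsequence u 0 (Suc n)) = insert q (Pal (subsequence u 0 n))"
    by simp
  show ?thesis
    unfolding defect_def new_pal_iff q
    by (auto simp: card_insert_if finite_Pal insert_absorb)
qed

text \<open>Along prefixes the defect grows by 0 or 1, and by 1 exactly where no new palindrome
  ends, so it is bounded iff it is eventually constant. Prefixes suffice, since every factor lies in
  one and \<open>defect_sublist\<close> applies.\<close>

lemma almost_rich_iff: "almost_rich u \<longleftrightarrow> (\<exists>n0. \<forall>n \<ge> n0. new_pal u n)"
proof
  assume "almost_rich u"
  then have fin: "defect_inf u < \<infinity>"
    by (simp add: almost_rich_def)
  define d where "d n = defect (subsequence u 0 n)" for n
  have le: "ereal (real_of_int (d n)) \<le> defect_inf u" for n
    unfolding defect_inf_def d_def using subsequence_in_factors[of u 0 n]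
    by (intro SUP_upper) simp
  obtain B where B: "d n \<le> B" for n
  proof (cases "defect_inf u")
    case (real r)
    then have "d n \<le> \<lceil>r\<rceil>" for n
      using le[of n] by (simp add: ceiling_mono le_of_int_ceiling order.trans of_int_le_iff) linarith
    then show ?thesis
      using that by blast
  qed (use fin le[of 0] in auto)
  have mono: "d m \<le> d n" if "m \<le> n" for m n
    using that by (rule lift_Suc_mono_le[rotated]) (simp add: d_def defect_prefix_Suc del: subseq_to_Suc)
  define M where "M = Max (range d)"
  have "range d \<subseteq> {d 0..B}"
    using B mono by auto
  then have finr: "finite (range d)"
    using finite_subset by blast
  \<comment> \<open>The maximum is reached at \<open>n0\<close>; a later position without a new
    palindrome would push the defect above it.\<close>
  obtain n0 where n0: "d n0 = M"
    using Max_in[OF finr] unfolding M_def by auto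
  have "new_pal u n" if "n \<ge> n0" for n
  proof (rule ccontr)
    assume "\<not> new_pal u n"
    then have "d (Suc n) = d n + 1"
      by (simp add: d_def defect_prefix_Suc del: subseq_to_Suc)
    moreover have "d (Suc n) \<le> d n0"
      using finr unfolding n0 M_def by simp
    ultimately show False
      using mono[OF that] by simp
  qed
  then show "\<exists>n0. \<forall>n \<ge> n0. new_pal u n"
    by blast
next
  assume "\<exists>n0. \<forall>n \<ge> n0. new_pal u n"
  then obtain n0 where n0: "\<And>n. n \<ge> n0 \<Longrightarrow> new_pal u n"
    by blast
  have const: "defect (subsequence u 0 (n0 + k)) = defect (subsequence u 0 n0)" for k
    by (induction k) (simp_all add: defect_prefix_Suc n0 del: subseq_to_Suc)
  have "defect w \<le> defect (subsequence u 0 n0)" if w: "w \<in> factors u" for w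
  proof -
    obtain i where i: "occurs_at w u i"
      using w by (auto simp: factors_def)
    have "sublist w (subsequence u 0 (n0 + (i + length w)))"
      unfolding sublist_prefix_iff using i by (intro exI[of _ i]) simp
    from defect_sublist[OF this] const show ?thesis
      by simp
  qed
  then have "defect_inf u \<le> ereal (real_of_int (defect (subsequence u 0 n0)))"
    unfolding defect_inf_def by (intro SUP_least) simp
  then show "almost_rich u"
    unfolding almost_rich_def by (auto simp: less_top[symmetric] top_ereal_def)
qed

section \<open>Complete returns to long palindromes\<close>

text \<open>Take the first place where \<open>c\<close> or \<open>rev c\<close> occurs, \<open>c\<close> being the complete return. The longest
  palindromic suffix there is new, hence longer than \<open>P\<close>; it cannot be strictly between \<open>P\<close> and \<open>c\<close>
  since \<open>P\<close> has no intermediate occurrence, and it is not longer than \<open>c\<close> since otherwise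
  its reversal would give an earlier occurrence of \<open>rev c\<close>.\<close>

lemma complete_return_palindrome:
  assumes good: "\<And>n. n \<ge> n0 \<Longrightarrow> new_pal u n"
    and len: "length P \<ge> n0" and pal: "rev P = P" and "i < j"
    and Pi: "occurs_at P u i" and Pj: "occurs_at P u j"
    and between: "\<And>k. i < k \<Longrightarrow> k < j \<Longrightarrow> \<not> occurs_at P u k"
  shows "rev (subsequence u i (j + length P)) = subsequence u i (j + length P)"
proof -
  define L where "L = length P"
  define c where "c = subsequence u i (j + L)"
  define m where "m = j - i"
  have m: "m > 0" "j = i + m"
    using \<open>i < j\<close> by (auto simp: m_def)
  have lc: "length c = m + L"
    by (simp add: c_def m)
  have Pk: "P ! (L - Suc k) = P ! k" if "k < L" for k
    using rev_nth_self[OF pal] that by (simp add: L_def)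
  have cn: "c ! k = u (i + k)" if "k < m + L" for k
    using that by (simp add: c_def m)
  have c1: "c ! k = P ! k" if "k < L" for k
    using Pi that by (simp add: cn occurs_at_iff L_def)
  have c2: "c ! (m + k) = P ! k" if "k < L" for k
    using Pj that by (simp add: cn occurs_at_iff L_def m add.assoc)
  have c3: "\<exists>k < L. c ! (t + k) \<noteq> P ! k" if "0 < t" "t < m" for t
    using between[of "i + t"] that by (auto simp: cn occurs_at_iff L_def m add.assoc)
  \<comment> \<open>As \<open>P\<close> is a palindrome, \<open>rev c\<close> inherits
    \<open>c1\<close> to \<open>c3\<close> as \<open>r1\<close> to \<open>r3\<close>; whichever of
    the two words occurs first can then be treated as a single \<open>d\<close>.\<close>
  have rn: "rev c ! k = c ! (m + L - Suc k)" if "k < m + L" for k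
    using that by (simp add: rev_nth lc)
  have r1: "rev c ! k = P ! k" if "k < L" for k
  proof -
    have "rev c ! k = c ! (m + (L - Suc k))"
      using that by (simp add: rn)
    then show ?thesis
      using that c2[of "L - Suc k"] Pk by simp
  qed
  have r2: "rev c ! (m + k) = P ! k" if "k < L" for k
    using that c1[of "L - Suc k"] Pk by (simp add: rn)
  have r3: "\<exists>k < L. rev c ! (t + k) \<noteq> P ! k" if t: "0 < t" "t < m" for t
  proof -
    obtain k where k: "k < L" "c ! ((m - t) + k) \<noteq> P ! k"
      using c3[of "m - t"] t by auto
    have "rev c ! (t + (L - Suc k)) = c ! (m + L - Suc (t + (L - Suc k)))"
      using k t by (intro rn) auto
    also have "m + L - Suc (t + (L - Suc k)) = (m - t) + k"
      using k t by auto
    finally show ?thesis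
      using k Pk[of k] by (intro exI[of _ "L - Suc k"]) auto
  qed
  define Q where "Q a \<longleftrightarrow> occurs_at c u a \<or> occurs_at (rev c) u a" for a
  define a where "a = (LEAST a. Q a)"
  have "Q i"
    by (simp add: Q_def occurs_at_iff lc cn)
  then have "Q a"
    unfolding a_def by (rule LeastI)
  have least: "a \<le> b" if "Q b" for b
    unfolding a_def using that by (rule Least_le)
  obtain d where d: "occurs_at d u a" "d = c \<or> d = rev c"
    using \<open>Q a\<close> by (auto simp: Q_def)
  have ld: "length d = m + L"
    using d(2) lc by auto
  have d1: "\<And>k. k < L \<Longrightarrow> d ! k = P ! k"
    and d2: "\<And>k. k < L \<Longrightarrow> d ! (m + k) = P ! k"
    and d3: "\<And>t. 0 < t \<Longrightarrow> t < m \<Longrightarrow> \<exists>k < L. d ! (t + k) \<noteq> P ! k"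
    using d(2) c1 c2 c3 r1 r2 r3 by auto
  have ud: "u (a + k) = d ! k" if "k < m + L" for k
    using d(1) that by (simp add: occurs_at_iff ld)
  \<comment> \<open>The last letter of this copy of \<open>d\<close>; \<open>n \<ge> n0\<close>
    follows from \<open>L \<ge> n0\<close> and \<open>m > 0\<close>.\<close>
  define n where "n = a + m + L - 1"
  have sn: "Suc n = a + m + L"
    using m by (simp add: n_def)
  have "new_pal u n"
    using len m by (intro good) (auto simp: n_def L_def)
  then obtain b where b: "b \<le> n" "rev (subsequence u b (Suc n)) = subsequence u b (Suc n)"
      "\<And>k. k < b \<Longrightarrow> \<not> occurs_at (subsequence u b (Suc n)) u k"
    unfolding new_pal_def by blast
  define q where "q = subsequence u b (Suc n)"
  have lq: "length q = Suc n - b"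
    by (simp add: q_def del: subseq_to_Suc)
  have qn: "q ! k = u (b + k)" if "k < Suc n - b" for k
    using that by (simp add: q_def del: subseq_to_Suc)
  have qr: "u (b + k) = u (b + (n - b - k))" if "k < Suc n - b" for k
    using rev_nth_self[of q k] b(2) that unfolding q_def[symmetric] lq
    by (simp add: qn Suc_diff_le)
  have "b < a + m"
  proof (rule ccontr)
    assume "\<not> b < a + m"
    then obtain t where t: "b = a + m + t"
      by (metis add.commute le_Suc_ex linorder_not_less)
    have "occurs_at q u (a + t)"
      unfolding occurs_at_iff
    proof (intro allI impI)
      fix k assume "k < length q"
      then have k: "t + k < L"
        using lq sn t by simp
      have "u (a + (t + k)) = u (a + (m + (t + k)))"
        using k by (simp only: ud d1 d2)
      then show "u (a + t + k) = q ! k"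
        using \<open>k < length q\<close> lq by (simp add: qn t add_ac)
    qed
    with b(3)[of "a + t"] m show False
      by (simp add: q_def t)
  qed
  moreover have "\<not> a < b"
  proof
    assume "a < b"
    then have "0 < b - a" "b - a < m"
      using \<open>b < a + m\<close> by auto
    from d3[OF this] obtain k where k: "k < L" "d ! (b - a + k) \<noteq> P ! k"
      by blast
    \<comment> \<open>Reflection in the palindrome from \<open>b\<close> to \<open>n\<close> carries
      the closing \<open>P\<close> to a copy starting at \<open>b\<close>, strictly inside
      \<open>d\<close>.\<close>
    have "d ! (b - a + k) = u (b + k)"
      using ud[of "b - a + k"] k \<open>a < b\<close> \<open>b < a + m\<close> by simp
    also have "\<dots> = u (b + (n - b - k))"
      using k \<open>b < a + m\<close> sn by (intro qr) simp
    also have "b + (n - b - k) = a + (m + (L - Suc k))"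
      using k \<open>b < a + m\<close> sn by simp
    also have "u \<dots> = P ! k"
      using k by (simp only: ud d2 Pk)
    finally show False
      using k by simp
  qed
  moreover have "\<not> b < a"
  proof
    assume "b < a"
    have "occurs_at (rev d) u b"
      unfolding occurs_at_iff
    proof (intro allI impI)
      fix k assume "k < length (rev d)"
      then have k: "k < m + L"
        by (simp add: ld)
      have "u (b + k) = u (b + (n - b - k))"
        using k \<open>b < a\<close> sn by (intro qr) simp
      also have "b + (n - b - k) = a + (m + L - Suc k)"
        using k \<open>b < a\<close> sn by simp
      also have "u \<dots> = d ! (m + L - Suc k)"
        using k by (intro ud) simp
      also have "\<dots> = rev d ! k"
        using k by (simp add: rev_nth ld)
      finally show "u (b + k) = rev d ! k" .
    qed
    then have "Q b"
      using d(2) by (auto simp: Q_def)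
    with least[of b] \<open>b < a\<close> show False
      by simp
  qed
  ultimately have "b = a"
    by simp
  then have "q = d"
    using d(1) ld sn by (auto simp: q_def occurs_at_def add.assoc simp del: subseq_to_Suc)
  then have "rev d = d"
    using b(2) by (simp add: q_def del: subseq_to_Suc)
  then show ?thesis
    using d(2) by (auto simp: c_def L_def)
qed

section \<open>Transitions between two palindromes\<close>

text \<open>Isolates what almost richness provides for a single long palindrome \<open>P\<close>, so
  that transitions can be studied without \<open>new_pal\<close>.\<close>

definition palindromic_returns :: "'a word \<Rightarrow> 'a list \<Rightarrow> bool" where
  "palindromic_returns u P \<longleftrightarrow> (\<forall>i j. i < j \<and> occurs_at P u i \<and> occurs_at P u j \<and>
     (\<forall>k. i < k \<and> k < j \<longrightarrow> \<not> occurs_at P u k) \<longrightarrow>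
     rev (subsequence u i (j + length P)) = subsequence u i (j + length P))"

definition transition :: "'a word \<Rightarrow> 'a list \<Rightarrow> 'a list \<Rightarrow> nat \<Rightarrow> nat \<Rightarrow> bool" where
  "transition u P Q a b \<longleftrightarrow> a < b \<and> occurs_at P u a \<and> occurs_at Q u b \<and>
     (\<forall>k. a < k \<and> k < b \<longrightarrow> \<not> occurs_at P u k \<and> \<not> occurs_at Q u k)"

lemma occurs_at_unique:
  "occurs_at P u a \<Longrightarrow> occurs_at Q u a \<Longrightarrow> length P = length Q \<Longrightarrow> P = Q"
  unfolding occurs_at_def by metis

text \<open>The complete return to \<open>P\<close> that starts at the beginning of a transition from \<open>P\<close> to \<open>Q\<close> is a
  palindrome, so the next transition, which leads from \<open>Q\<close> back to \<open>P\<close>, is its mirror image.\<close>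

lemma next_transition:
  assumes ret: "palindromic_returns u P"
    and palQ: "rev Q = Q" and len: "length P = length Q" and "P \<noteq> Q"
    and t: "transition u P Q a b" and e: "b < e" "occurs_at P u e"
  obtains c d where "transition u Q P c d" "b \<le> c" "\<forall>k. b < k \<and> k < d \<longrightarrow> \<not> occurs_at P u k"
    "subsequence u c (d + length P) = rev (subsequence u a (b + length P))"
proof -
  define L where "L = length P"
  note t' = t[unfolded transition_def]
  \<comment> \<open>With \<open>d\<close> the first \<open>P\<close> after \<open>b\<close>, the
    stretch from \<open>a\<close> to \<open>d\<close> is a complete return to
    \<open>P\<close>.\<close>
  define d where "d = (LEAST d. b < d \<and> occurs_at P u d)"
  have d: "b < d" "occurs_at P u d"
    using LeastI[of "\<lambda>d. b < d \<and> occurs_at P u d" e] e by (auto simp: d_def)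
  have dmin: "\<not> occurs_at P u k" if "b < k" "k < d" for k
    using not_less_Least[of k "\<lambda>d. b < d \<and> occurs_at P u d"] that by (auto simp: d_def)
  have "\<not> occurs_at P u b"
    using t' occurs_at_unique[of P u b Q] len \<open>P \<noteq> Q\<close> by blast
  then have noP: "\<not> occurs_at P u k" if "a < k" "k < d" for k
    using that t' dmin[of k] by (cases "k < b"; cases "k = b") auto
  \<comment> \<open>The last \<open>Q\<close> before \<open>d\<close> starts the transition back to
    \<open>P\<close>.\<close>
  have "\<exists>c. (c < d \<and> occurs_at Q u c) \<and> (\<forall>k. k < d \<and> occurs_at Q u k \<longrightarrow> k \<le> c)"
    using t' d by (intro ex_has_greatest_nat[of _ b "\<lambda>k. k" d]) auto
  then obtain c where c: "c < d" "occurs_at Q u c"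
      and cmax: "\<And>k. k < d \<Longrightarrow> occurs_at Q u k \<Longrightarrow> k \<le> c"
    by blast
  have "b \<le> c"
    using cmax t' d by blast
  have tr: "transition u Q P c d"
    unfolding transition_def
  proof (intro conjI allI impI; (elim conjE)?)
    fix k assume k: "c < k" "k < d"
    show "\<not> occurs_at Q u k"
      using cmax[of k] k by auto
    show "\<not> occurs_at P u k"
      using dmin[of k] k \<open>b \<le> c\<close> by simp
  qed (use c d in auto)
  have "rev (subsequence u a (d + L)) = subsequence u a (d + L)"
    using ret t' d noP unfolding palindromic_returns_def L_def by force
  from rev_nth_self[OF this]
  have mir: "u (a + k) = u (d + L - Suc k)" if "k < d + L - a" for k
    using that t' d by simp
  have Qk: "Q ! (L - Suc k) = Q ! k" if "k < L" for k
    using rev_nth_self[OF palQ] that by (simp add: L_def len)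
  \<comment> \<open>Reflecting the return sends a copy of \<open>Q\<close> at \<open>k\<close> to
    one at \<open>a + d - k\<close>, because \<open>Q\<close> is a palindrome as long as
    \<open>P\<close>.\<close>
  have mirQ: "occurs_at Q u (a + d - k)" if k: "a \<le> k" "k \<le> d" "occurs_at Q u k" for k
    unfolding occurs_at_iff
  proof (intro allI impI)
    fix r assume "r < length Q"
    then have r: "r < L"
      by (simp add: L_def len)
    have "u (a + d - k + r) = u (a + (d - k + r))"
      using k by (intro arg_cong[of _ _ u]) arith
    also have "\<dots> = u (d + L - Suc (d - k + r))"
      using k r by (intro mir) auto
    also have "d + L - Suc (d - k + r) = k + (L - Suc r)"
      using k r by simp
    also have "u \<dots> = Q ! (L - Suc r)"
      using k(3)[unfolded occurs_at_iff, rule_format, of "L - Suc r"] r by (simp add: L_def len)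
    finally show "u (a + d - k + r) = Q ! r"
      using r by (simp add: Qk)
  qed
  \<comment> \<open>\<open>b\<close> and \<open>c\<close> are the first and the last
    \<open>Q\<close> in the return, so the reflection exchanges them.\<close>
  have "b \<le> a + d - c"
  proof (rule ccontr)
    assume "\<not> b \<le> a + d - c"
    moreover have "occurs_at Q u (a + d - c)"
      using c \<open>b \<le> c\<close> t' by (intro mirQ) auto
    ultimately show False
      using t' c by auto
  qed
  moreover have "a + d - b \<le> c"
    using t' d by (intro cmax mirQ) auto
  ultimately have bc: "a + d = b + c"
    using t' d by linarith
  have "subsequence u c (d + L) = rev (subsequence u a (b + L))"
  proof (rule nth_equalityI)
    show "length (subsequence u c (d + L)) = length (rev (subsequence u a (b + L)))"
      using bc t' c by simp
    fix k assume "k < length (subsequence u c (d + L))"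
    then have k: "k < d + L - c" "k < b + L - a"
      using bc t' c by auto
    then have "rev (subsequence u a (b + L)) ! k = u (a + (b + L - a - Suc k))"
      by (simp add: rev_nth)
    also have "\<dots> = u (d + L - Suc (b + L - a - Suc k))"
      using k d by (intro mir) auto
    also have "d + L - Suc (b + L - a - Suc k) = c + k"
      using k bc by simp
    finally show "subsequence u c (d + L) ! k = rev (subsequence u a (b + L)) ! k"
      using k by simp
  qed
  then show ?thesis
    unfolding L_def using that tr \<open>b \<le> c\<close> dmin by blast
qed

text \<open>Induction on the distance \<open>a' - a\<close>: \<open>next_transition\<close> replaces
  the first transition by the following one, whose word is the reversal, and a word and its reversal
  form a set stable under reversal. \<open>P\<close> and \<open>Q\<close> swap roles at each step,
  so both are generalized.\<close>

lemma transitions_mirror: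
  assumes "palindromic_returns u P" "palindromic_returns u Q" and "rev P = P" "rev Q = Q" and "length P = length Q" and "P \<noteq> Q"
    and "transition u P Q a b"
    and "transition u P Q a' b' \<or> transition u Q P a' b'" and "a \<le> a'"
  shows "subsequence u a' (b' + length P) \<in>
    {subsequence u a (b + length P), rev (subsequence u a (b + length P))}"
  using assms
proof (induction "a' - a" arbitrary: P Q a b rule: less_induct)
  case less
  note t = less.prems(7)[unfolded transition_def]
  have PQ: "\<not> (occurs_at P u k \<and> occurs_at Q u k)" for k
    using occurs_at_unique[of P u k Q] less.prems(5,6) by blast
  have occ: "occurs_at P u a' \<or> occurs_at Q u a'"
    using less.prems(8) by (auto simp: transition_def)
  show ?case
  proof (cases "a' = a")
    case True
    then have "transition u P Q a b'"
      using less.prems(8) t PQ[of a] by (auto simp: transition_def)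
    then have "b' = b"
      using t by (cases b' b rule: linorder_cases) (auto simp: transition_def)
    then show ?thesis
      using True by simp
  next
    case False
    then have "a < a'"
      using less.prems(9) by simp
    have "b \<le> a'"
      using t occ \<open>a < a'\<close> by (intro leI notI) blast
    have Pb: "\<not> occurs_at P u b"
      using PQ[of b] t by blast
    have "a < b"
      using t by blast
    \<comment> \<open>The second transition starts or ends with \<open>P\<close>, and that copy lies
      after \<open>b\<close>.\<close>
    have "\<exists>e. b < e \<and> occurs_at P u e"
    proof (cases "occurs_at P u a'")
      case True
      then have "a' \<noteq> b"
        using Pb by blast
      with True \<open>b \<le> a'\<close> show ?thesis
        by (intro exI[of _ a']) simp
    next
      case False
      then have "occurs_at P u b'" "a' < b'"
        using less.prems(8) by (auto simp: transition_def)
      with \<open>b \<le> a'\<close> show ?thesis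
        by (intro exI[of _ b']) simp
    qed
    then obtain e where e: "b < e" "occurs_at P u e"
      by blast
    obtain c d where cd: "transition u Q P c d" "b \<le> c"
      "\<forall>k. b < k \<and> k < d \<longrightarrow> \<not> occurs_at P u k"
      "subsequence u c (d + length P) = rev (subsequence u a (b + length P))"
      by (rule next_transition[OF less.prems(1,4-7) e])
    \<comment> \<open>No transition starts from \<open>b\<close> on and before \<open>c\<close>:
      there is no \<open>P\<close> at \<open>b\<close> or strictly between \<open>b\<close> and
      \<open>d\<close>, and a transition from \<open>Q\<close> would have to pass the
      \<open>Q\<close> at \<open>c\<close> before reaching the next \<open>P\<close>.\<close>
    have "c \<le> a'"
    proof (rule ccontr)
      assume nc: "\<not> c \<le> a'"
      have c: "c < d" "occurs_at Q u c"
        using cd(1) by (auto simp: transition_def)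
      have "b' < d" if "transition u Q P a' b'"
      proof (rule ccontr)
        assume "\<not> b' < d"
        then have "a' < c" "c < b'"
          using nc c(1) by auto
        with that c(2) show False
          by (auto simp: transition_def)
      qed
      moreover have "b < b'" "occurs_at P u b'" if "transition u Q P a' b'"
        using that \<open>b \<le> a'\<close> by (auto simp: transition_def)
      ultimately have "\<not> transition u Q P a' b'"
        using cd(3) by blast
      then have "occurs_at P u a'"
        using less.prems(8) by (auto simp: transition_def)
      moreover from this have "b < a'"
        using \<open>b \<le> a'\<close> Pb by (cases "a' = b") auto
      ultimately show False
        using cd(3) nc c(1) by simp
    qed
    have res: "subsequence u a' (b' + length Q) \<in>
      {subsequence u c (d + length Q), rev (subsequence u c (d + length Q))}"
    proof (rule less.hyps)
      show "a' - c < a' - a"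
        using \<open>a < b\<close> \<open>b \<le> c\<close> \<open>c \<le> a'\<close> by linarith
      show "transition u Q P a' b' \<or> transition u P Q a' b'"
        using less.prems(8) by blast
    qed (use less.prems(1-6) cd(1) \<open>c \<le> a'\<close> in simp_all)
    show ?thesis
      using res[folded less.prems(5), unfolded cd(4)] by auto
  qed
qed

section \<open>The map \<open>S\<close> and the exchange of letters\<close>

text \<open>A letter of \<open>S u\<close> tells whether two adjacent letters of \<open>u\<close>
  agree, so when the images coincide, equality or difference at one place propagates to the whole
  stretch. The \<open>l\<close> letters of the image stand for \<open>l + 1\<close> letters of
  \<open>u\<close>.\<close>

lemma S_eq_iff:
  assumes "range u \<subseteq> {0, 1}"
  shows "(\<forall>k < l. S u (i + k) = S u (j + k)) \<longleftrightarrow>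
    (\<forall>k \<le> l. u (i + k) = u (j + k)) \<or> (\<forall>k \<le> l. u (i + k) = 1 - u (j + k))"
proof (induction l)
  case 0
  have "u i \<in> {0, 1}" "u j \<in> {0, 1}"
    using assms by blast+
  then show ?case
    by auto
next
  case (Suc l)
  have "u (i + l) \<in> {0, 1}" "u (j + l) \<in> {0, 1}"
    "u (Suc (i + l)) \<in> {0, 1}" "u (Suc (j + l)) \<in> {0, 1}"
    using assms by blast+
  then have "S u (i + l) = S u (j + l) \<longleftrightarrow>
      (u (i + l) = u (j + l) \<longleftrightarrow> u (Suc (i + l)) = u (Suc (j + l)))"
    and "u (i + l) = 1 - u (j + l) \<longleftrightarrow> u (i + l) \<noteq> u (j + l)"
    and "u (Suc (i + l)) = 1 - u (Suc (j + l)) \<longleftrightarrow> u (Suc (i + l)) \<noteq> u (Suc (j + l))"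
    by (auto simp: S_def)
  moreover have "(\<forall>k < Suc l. S u (i + k) = S u (j + k)) \<longleftrightarrow>
      (\<forall>k < l. S u (i + k) = S u (j + k)) \<and> S u (i + l) = S u (j + l)"
    by (auto simp: less_Suc_eq)
  moreover have "(\<forall>k \<le> Suc l. R k) \<longleftrightarrow> (\<forall>k \<le> l. R k) \<and> R l \<and> R (Suc l)" for R
    by (auto simp: le_Suc_eq)
  ultimately show ?case
    unfolding Suc.IH by simp blast
qed

text \<open>The exchange of letters \<open>E\<close>; subtraction on naturals is truncated, so it is
  an involution on binary words only.\<close>

definition compl_word :: "nat list \<Rightarrow> nat list" where
  "compl_word = map (\<lambda>x. 1 - x)"

lemma length_compl_word [simp]: "length (compl_word w) = length w"
  by (simp add: compl_word_def)

lemma nth_compl_word [simp]: "k < length w \<Longrightarrow> compl_word w ! k = 1 - w ! k"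
  by (simp add: compl_word_def)

lemma compl_word_neq: "w \<noteq> [] \<Longrightarrow> compl_word w \<noteq> w"
proof
  assume "w \<noteq> []" "compl_word w = w"
  then have "1 - hd w = hd w"
    by (metis compl_word_def hd_map)
  then show False
    by arith
qed

text \<open>Exchanging both letters preserves their sum mod 2, so either symmetry of
  \<open>f\<close> makes its image a palindrome; by \<open>S_eq_iff\<close> an earlier copy of the
  image would come from \<open>f\<close> or \<open>compl_word f\<close>. The image is one letter
  shorter and ends at \<open>m\<close>, while \<open>f\<close> ends at \<open>Suc m\<close>.\<close>

lemma new_pal_S:
  assumes bin: "range u \<subseteq> {0, 1}" and "i \<le> m"
    and f: "f = subsequence u i (Suc (Suc m))"
    and sym: "rev f = f \<or> rev f = compl_word f"
    and first: "\<And>j. j < i \<Longrightarrow> \<not> occurs_at f u j \<and> \<not> occurs_at (compl_word f) u j"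
  shows "new_pal (S u) m"
proof -
  define l where "l = Suc m - i"
  have l: "Suc m = i + l"
    using \<open>i \<le> m\<close> by (simp add: l_def)
  have lf: "length f = Suc l"
    by (simp add: f l del: subseq_to_Suc)
  have fn: "f ! k = u (i + k)" if "k \<le> l" for k
    using that by (simp add: f l del: subseq_to_Suc)
  have b: "u k = 0 \<or> u k = 1" for k
    using bin by blast
  have sym': "(\<forall>k \<le> l. u (i + (l - k)) = u (i + k)) \<or> (\<forall>k \<le> l. u (i + (l - k)) = 1 - u (i + k))"
    using sym
  proof
    assume "rev f = f"
    then have "f ! (l - k) = f ! k" if "k \<le> l" for k
      using rev_nth_self[of f k] that lf by simp
    then show ?thesis
      by (simp add: fn)
  next
    assume r: "rev f = compl_word f"
    have "f ! (l - k) = 1 - f ! k" if "k \<le> l" for k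
      using rev_nth[of k f] nth_compl_word[of k f] that lf r by simp
    then show ?thesis
      by (simp add: fn)
  qed
  define q where "q = subsequence (S u) i (Suc m)"
  have lq: "length q = l"
    by (simp add: q_def l del: subseq_to_Suc)
  have qn: "q ! k = S u (i + k)" if "k < l" for k
    using that by (simp add: q_def l del: subseq_to_Suc)
  have "S u (i + (l - Suc k)) = S u (i + k)" if "k < l" for k
  proof -
    have "i + (l - Suc k) + 1 = i + (l - k)"
      using that by simp
    then have "S u (i + (l - Suc k)) = (u (i + (l - Suc k)) + u (i + (l - k))) mod 2"
      by (simp only: S_def)
    moreover have "k \<le> l" "Suc k \<le> l"
      using that by auto
    ultimately show ?thesis
      using sym' b[of "i + k"] b[of "i + Suc k"] by (auto simp: S_def)
  qed
  then have "rev q = q"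
    by (simp add: rev_eq_self_iff lq qn)
  moreover have "\<not> occurs_at q (S u) j" if "j < i" for j
  proof
    assume "occurs_at q (S u) j"
    then have "\<forall>k < l. S u (j + k) = S u (i + k)"
      by (simp add: occurs_at_iff lq qn)
    then have "occurs_at f u j \<or> occurs_at (compl_word f) u j"
      unfolding S_eq_iff[OF bin] by (simp add: occurs_at_iff lf fn less_Suc_eq_le)
    with first that show False
      by blast
  qed
  ultimately show ?thesis
    unfolding new_pal_def q_def using \<open>i \<le> m\<close> by blast
qed

section \<open>Consequences of recurrence and of a finite alphabet\<close>

lemma uniformly_recurrent_bounded_gaps:
  assumes "uniformly_recurrent u" and "w \<in> factors u"
  obtains N where "\<And>i. \<exists>j. i \<le> j \<and> j \<le> i + N \<and> occurs_at w u j"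
proof -
  obtain K where inf: "infinite {i. occurs_at w u i}"
    and K: "\<forall>i j. i < j \<and> occurs_at w u i \<and> occurs_at w u j \<and>
      (\<forall>k. i < k \<and> k < j \<longrightarrow> \<not> occurs_at w u k) \<longrightarrow> j - i \<le> K"
    using assms unfolding uniformly_recurrent_def by blast
  obtain i0 where i0: "occurs_at w u i0"
    using assms(2) by (auto simp: factors_def)
  \<comment> \<open>The summand \<open>i0\<close> covers starts up to the known occurrence
    \<open>i0\<close>; beyond it, the last occurrence before \<open>i\<close> and the next one are
    consecutive.\<close>
  have "\<exists>j. i \<le> j \<and> j \<le> i + (i0 + K) \<and> occurs_at w u j" for i
  proof -
    have ex: "\<exists>j. i \<le> j \<and> occurs_at w u j"
      using inf by (auto simp: infinite_nat_iff_unbounded_le)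
    define j where "j = (LEAST j. i \<le> j \<and> occurs_at w u j)"
    have j: "i \<le> j" "occurs_at w u j"
      using LeastI_ex[OF ex] by (auto simp: j_def)
    have jmin: "j \<le> k" if "i \<le> k" "occurs_at w u k" for k
      unfolding j_def using that by (intro Least_le) auto
    have "j \<le> i + (i0 + K)"
    proof (cases "i \<le> i0")
      case True
      then show ?thesis
        using jmin i0 by fastforce
    next
      case False
      then have "\<exists>c. (c < i \<and> occurs_at w u c) \<and> (\<forall>k. k < i \<and> occurs_at w u k \<longrightarrow> k \<le> c)"
        using i0 by (intro ex_has_greatest_nat[of _ i0 "\<lambda>k. k" i]) auto
      then obtain c where c: "c < i" "occurs_at w u c"
        and cmax: "\<And>k. k < i \<Longrightarrow> occurs_at w u k \<Longrightarrow> k \<le> c"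
        by blast
      have "\<not> occurs_at w u k" if "c < k" "k < j" for k
        using that cmax[of k] jmin[of k] by (cases "k < i") auto
      then have "j - c \<le> K"
        using K c j by simp
      then show ?thesis
        using c by simp
    qed
    with j show ?thesis
      by blast
  qed
  then show ?thesis
    using that by blast
qed

text \<open>There are finitely many short factors; the largest end of one chosen occurrence of each
  is the bound. It forces late new palindromes to be long.\<close>

lemma short_factors_occur_early:
  assumes "finite (range u)"
  obtains n where "\<And>w. w \<in> factors u \<Longrightarrow> length w \<le> M \<Longrightarrow> \<exists>j. j + length w \<le> n \<and> occurs_at w u j"
proof -
  define F where "F = {w \<in> factors u. length w \<le> M}"
  have "set w \<subseteq> range u" if w: "w \<in> factors u" for w
  proof -
    obtain i where "subsequence u i (i + length w) = w"
      using w by (auto simp: factors_def occurs_at_def)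
    then have "set w = u ` {i..<i + length w}"
      by (metis set_subsequence)
    then show ?thesis
      by blast
  qed
  then have "F \<subseteq> {w. set w \<subseteq> range u \<and> length w \<le> M}"
    by (auto simp: F_def)
  then have fin: "finite F"
    using finite_lists_length_le[OF assms] finite_subset by blast
  have "\<forall>w \<in> F. \<exists>j. occurs_at w u j"
    by (auto simp: F_def factors_def)
  then obtain p where p: "\<And>w. w \<in> F \<Longrightarrow> occurs_at w u (p w)"
    by metis
  have "p w + length w \<le> Max ((\<lambda>w. p w + length w) ` F)" if "w \<in> F" for w
    using fin that by simp
  with p show ?thesis
    using that unfolding F_def by blast
qed

section \<open>Almost richness of the image\<close>

theorem mainTheorem3:
  fixes u :: "nat word"
  assumes "range u \<subseteq> {0, 1}"
    and "uniformly_recurrent u"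
    and "almost_rich u"
  shows "almost_rich (S u)"
proof -
  obtain n0 where n0: "\<And>n. n \<ge> n0 \<Longrightarrow> new_pal u n"
    using assms(3) unfolding almost_rich_iff by blast
  have ret: "palindromic_returns u P" if "rev P = P" "length P \<ge> n0" for P
    unfolding palindromic_returns_def using complete_return_palindrome[OF n0 that(2,1)] by blast
  have b: "u k = 0 \<or> u k = 1" for k
    using assms(1) by blast
  \<comment> \<open>If some factor \<open>w\<close> has no exchanged copy in \<open>u\<close>, then
    neither has any factor long enough to contain \<open>w\<close> for sure; otherwise any
    \<open>N\<close> serves.\<close>
  obtain N where N: "\<And>P w. P \<in> factors u \<Longrightarrow> length P \<ge> N \<Longrightarrow> compl_word P \<in> factors u \<Longrightarrow>
      w \<in> factors u \<Longrightarrow> compl_word w \<in> factors u"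
  proof (cases "\<forall>w \<in> factors u. compl_word w \<in> factors u")
    case True
    then show ?thesis
      using that by blast
  next
    case False
    then obtain w where w: "w \<in> factors u" "compl_word w \<notin> factors u"
      by blast
    obtain K where K: "\<And>i. \<exists>j. i \<le> j \<and> j \<le> i + K \<and> occurs_at w u j"
      using uniformly_recurrent_bounded_gaps[OF assms(2) w(1)] by blast
    have "compl_word P \<notin> factors u" if P: "P \<in> factors u" "length P \<ge> K + length w" for P
    proof
      assume "compl_word P \<in> factors u"
      then obtain i i' where i: "occurs_at P u i" and i': "occurs_at (compl_word P) u i'"
        using P by (auto simp: factors_def)
      obtain j where j: "i \<le> j" "j \<le> i + K" "occurs_at w u j"
        using K by blast
      have "u (i' + (j - i) + k) = compl_word w ! k" if k: "k < length w" for k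
      proof -
        have "j - i + k < length P"
          using P j k by simp
        then have "u (i' + (j - i + k)) = 1 - u (i + (j - i + k))"
          using i i' by (simp add: occurs_at_iff)
        then show ?thesis
          using j k by (simp add: occurs_at_iff add.assoc[symmetric])
      qed
      then have "occurs_at (compl_word w) u (i' + (j - i))"
        by (simp add: occurs_at_iff)
      with w show False
        by (auto simp: factors_def)
    qed
    then show ?thesis
      using that by blast
  qed
  have "finite (range u)"
    using assms(1) finite_subset by blast
  then obtain n1 where n1: "\<And>w. w \<in> factors u \<Longrightarrow> length w \<le> Suc (n0 + N) \<Longrightarrow>
      \<exists>j. j + length w \<le> n1 \<and> occurs_at w u j"
    using short_factors_occur_early by blast
  have "new_pal (S u) m" if m: "m \<ge> n0 + n1" for m
  proof -
    \<comment> \<open>A palindrome of \<open>S u\<close> ending at \<open>m\<close> comes from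
      letters of \<open>u\<close> up to \<open>Suc m\<close>.\<close>
    obtain i where i: "i \<le> Suc m"
      and "rev (subsequence u i (Suc (Suc m))) = subsequence u i (Suc (Suc m))"
      and "\<And>j. j < i \<Longrightarrow> \<not> occurs_at (subsequence u i (Suc (Suc m))) u j"
      using n0[of "Suc m"] m unfolding new_pal_def by auto
    moreover define p where "p = subsequence u i (Suc (Suc m))"
    ultimately have pal: "rev p = p" and new: "\<And>j. j < i \<Longrightarrow> \<not> occurs_at p u j"
      by auto
    have lp: "i + length p = Suc (Suc m)"
      using i by (simp add: p_def del: subseq_to_Suc)
    have pi: "occurs_at p u i"
      unfolding occurs_at_def lp by (simp add: p_def del: subseq_to_Suc)
    then have pf: "p \<in> factors u"
      by (auto simp: factors_def)
    \<comment> \<open>A short factor already lies within the first \<open>n1\<close> letters. Here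
      \<open>n0\<close> serves \<open>ret\<close>, \<open>N\<close> serves the closure under
      exchange, and \<open>Suc\<close> gives \<open>i \<le> m\<close>.\<close>
    have long: "length p > Suc (n0 + N)"
    proof (rule ccontr)
      assume "\<not> ?thesis"
      then obtain j where "j + length p \<le> n1" "occurs_at p u j"
        using n1[OF pf] by auto
      then show False
        using new[of j] lp m by simp
    qed
    show ?thesis
    proof (cases "\<exists>j < i. occurs_at (compl_word p) u j")
      case False
      then show ?thesis
        using long lp pal new by (intro new_pal_S[OF assms(1) _ p_def]) auto
    next
      case True
      then have "\<exists>j. (j < i \<and> occurs_at (compl_word p) u j) \<and>
          (\<forall>k. k < i \<and> occurs_at (compl_word p) u k \<longrightarrow> k \<le> j)"
        by (elim exE) (rule ex_has_greatest_nat[of _ _ "\<lambda>k. k" i]; auto)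
      then obtain j where j: "j < i" "occurs_at (compl_word p) u j"
        and jmax: "\<And>k. k < i \<Longrightarrow> occurs_at (compl_word p) u k \<Longrightarrow> k \<le> j"
        by blast
      have tr: "transition u (compl_word p) p j i"
        unfolding transition_def using j pi new jmax by (meson leD)
      define f where "f = subsequence u j (Suc (Suc m))"
      have lf: "length f = i - j + length p"
        using lp j by (simp add: f_def del: subseq_to_Suc)
      have f_eq: "f = subsequence u j (i + length p)"
        by (simp add: f_def lp)
      have fn: "f ! k = u (j + k)" if "k < i - j + length p" for k
        using that j by (simp add: f_eq)
      have "f \<in> factors u"
        unfolding factors_def occurs_at_def using lf f_eq j by (auto intro!: exI[of _ j])
      then have cf: "compl_word f \<in> factors u"
        using N[OF pf, of f] j long by (auto simp: factors_def)
      \<comment> \<open>Recurrence puts this copy at or after \<open>j\<close>, as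
        \<open>transitions_mirror\<close> requires.\<close>
      then obtain a where a: "j \<le> a" "occurs_at (compl_word f) u a"
        using uniformly_recurrent_bounded_gaps[OF assms(2) cf] by blast
      have ua: "u (a + k) = 1 - u (j + k)" if "k < i - j + length p" for k
        using a that by (simp add: occurs_at_iff lf fn)
      \<comment> \<open>Within the exchanged copy of \<open>f\<close> at \<open>a\<close>, the words
        \<open>p\<close> and \<open>compl_word p\<close> trade places, so that it is a transition in
        the opposite direction.\<close>
      have occ: "occurs_at p u (a + t) \<longleftrightarrow> occurs_at (compl_word p) u (j + t)"
          "occurs_at (compl_word p) u (a + t) \<longleftrightarrow> occurs_at p u (j + t)" if t: "t \<le> i - j" for t
      proof -
        have "u (a + t + k) = 1 - u (j + t + k)" if "k < length p" for k
          using ua[of "t + k"] t that by (simp add: add.assoc)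
        moreover have "p ! k = 0 \<or> p ! k = 1" if "k < length p" for k
          using pi b[of "i + k"] that by (simp add: occurs_at_iff)
        moreover note b
        ultimately show "occurs_at p u (a + t) \<longleftrightarrow> occurs_at (compl_word p) u (j + t)"
          "occurs_at (compl_word p) u (a + t) \<longleftrightarrow> occurs_at p u (j + t)"
          by (auto simp: occurs_at_iff) (metis One_nat_def diff_self_eq_0 diff_zero zero_neq_one)+
      qed
      have tr': "transition u p (compl_word p) a (a + (i - j))"
        unfolding transition_def
      proof (intro conjI allI impI; (elim conjE)?)
        fix k assume k: "a < k" "k < a + (i - j)"
        then obtain t where t: "k = a + t" "0 < t" "t < i - j"
          using less_imp_add_positive[of a k] by auto
        then show "\<not> occurs_at p u k" "\<not> occurs_at (compl_word p) u k"
          using tr occ[of t] by (auto simp: transition_def)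
      qed (use j pi occ[of 0] occ[of "i - j"] in auto)
      have cpal: "rev (compl_word p) = compl_word p"
        using pal by (simp add: compl_word_def rev_map)
      have "compl_word f = subsequence u a (a + (i - j) + length p)"
        using a(2) by (simp add: occurs_at_def lf add.assoc)
      also have "\<dots> \<in> {f, rev f}"
        using transitions_mirror[OF ret ret cpal pal _ _ tr disjI2[OF tr'] a(1)] pal cpal
          long compl_word_neq[of p] by (cases "p = []") (simp_all add: f_eq)
      \<comment> \<open>The alternative \<open>compl_word f = f\<close> is excluded since
        \<open>f\<close> is nonempty.\<close>
      finally have sym: "rev f = compl_word f"
        using compl_word_neq[of f] lf long by (cases "f = []") auto
      show ?thesis
      proof (rule new_pal_S[OF assms(1) _ f_def])
        \<comment> \<open>\<open>f\<close> ends with \<open>p\<close>, and \<open>rev f\<close>,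
          which is \<open>compl_word f\<close>, begins with \<open>p\<close>; either word before
          \<open>j\<close> would give a copy of \<open>p\<close> before \<open>i\<close>.\<close>
        fix j' assume j': "j' < j"
        have "\<not> occurs_at f u j'"
        proof
          assume f: "occurs_at f u j'"
          have "u (j' + (i - j) + k) = p ! k" if "k < length p" for k
          proof -
            have "u (j' + (i - j + k)) = u (j + (i - j + k))"
              using f that by (simp add: occurs_at_iff lf fn)
            also have "\<dots> = p ! k"
              using pi that j by (simp add: occurs_at_iff)
            finally show ?thesis
              by (simp add: add.assoc)
          qed
          then have "occurs_at p u (j' + (i - j))"
            by (simp add: occurs_at_iff)
          with new[of "j' + (i - j)"] j j' show False
            by simp
        qed
        moreover have "\<not> occurs_at (rev f) u j'"
        proof
          assume f: "occurs_at (rev f) u j'"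
          have "u (j' + k) = p ! k" if k: "k < length p" for k
          proof -
            have "u (j' + k) = f ! (length f - Suc k)"
              using f k by (simp add: occurs_at_iff rev_nth lf)
            also have "length f - Suc k = (i - j) + (length p - Suc k)"
              using k lf by simp
            also have "f ! \<dots> = u (j + ((i - j) + (length p - Suc k)))"
              using k by (intro fn) simp
            also have "j + ((i - j) + (length p - Suc k)) = i + (length p - Suc k)"
              using j by simp
            also have "u \<dots> = p ! (length p - Suc k)"
              using pi[unfolded occurs_at_iff, rule_format, of "length p - Suc k"] k by simp
            finally show ?thesis
              using rev_nth_self[OF pal k] by simp
          qed
          then have "occurs_at p u j'"
            by (simp add: occurs_at_iff)
          with new[of j'] j j' show False
            by simp
        qed
        ultimately show "\<not> occurs_at f u j' \<and> \<not> occurs_at (compl_word f) u j'"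
          by (simp add: sym)
      qed (use sym j i in auto)
    qed
  qed
  then show ?thesis
    unfolding almost_rich_iff by blast
qed

end
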